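(* There is a Type I $\omega$-bounded space $Q$, which is a subspace of $\beta\omega$ (the Čech–Stone compactification of the discrete space $\omega$), such that $Q$ contains no direction.
   Context: All spaces are Hausdorff and all functions are continuous unless otherwise specified. A space $X$ is Type I if $X=\bigcup_{\alpha<\omega_1}X_\alpha$ with each $X_\alpha$ open, $\overline{X_\alpha}$ Lindelöf, and $\overline{X_\alpha}\subset X_\beta$ whenever $\alpha<\beta$; Type I spaces are always assumed non-Lindelöf. A subset of a Type I space is bounded if it is contained in some $X_\alpha$, otherwise unbounded; a function into a Type I space is (un)bounded if its range is. Club means closed and unbounded. $\mathbb{L}_{\ge 0}$ is the closed long ray $\omega_1\times[0,1)$ with the lexicographic order topology (with $X_\alpha=[0,\alpha)$). A direction in a Type I space $X$ is a club $D\subset X$ such that for every continuous $f:X\to\mathbb{L}_{\ge 0}$, if $f$ is unbounded on $D$ then $f$ is unbounded on every club subset of $D$. A space is $\omega$-bounded if the closure of every countable subset is compact. *)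

theory Defs
  imports "HOL-Analysis.Analysis"
begin

unbundle cardinal_syntax

text \<open>
  HOL has no type of ordinals.  \<open>\<omega>\<^sub>1\<close> is the well-order underlying the
  cardinal successor of \<open>\<aleph>\<^sub>0\<close>; it is uncountable, while each of its proper
  initial segments is countable (\<open>uncountable_omega1\<close>,
  \<open>countable_lessThan_omega1\<close>).
\<close>

lemma cardSuc_natLeq: "Card_order (cardSuc natLeq)" "natLeq <o cardSuc natLeq"
  by (simp_all add: cardSuc_Card_order cardSuc_greater natLeq_Card_order)

lemma Well_order_cardSuc_natLeq: "Well_order (cardSuc natLeq)"
  using cardSuc_natLeq(1) by (rule card_order_on_well_order_on)

lemma infinite_Field_cardSuc_natLeq: "infinite (Field (cardSuc natLeq))"
  using cardSuc_finite[OF natLeq_Card_order] by (simp add: Field_natLeq)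

typedef omega1 = "Field (cardSuc natLeq)"
  using infinite_Field_cardSuc_natLeq by (metis finite.emptyI equals0I)

instantiation omega1 :: wellorder
begin

definition less_eq_omega1 :: "omega1 \<Rightarrow> omega1 \<Rightarrow> bool" where
  "a \<le> b \<longleftrightarrow> (Rep_omega1 a, Rep_omega1 b) \<in> cardSuc natLeq"

definition less_omega1 :: "omega1 \<Rightarrow> omega1 \<Rightarrow> bool" where
  "a < b \<longleftrightarrow> a \<le> b \<and> a \<noteq> b" for a b :: omega1

instance
proof
  have lin: "Linear_order (cardSuc natLeq)" and wf: "wf (cardSuc natLeq - Id)"
    using Well_order_cardSuc_natLeq by (auto simp: well_order_on_def)
  have refl: "\<And>x. x \<in> Field (cardSuc natLeq) \<Longrightarrow> (x, x) \<in> cardSuc natLeq"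
    and tr: "trans (cardSuc natLeq)" and anti: "antisym (cardSuc natLeq)"
    and tot: "total_on (Field (cardSuc natLeq)) (cardSuc natLeq)"
    using lin by (auto simp: linear_order_on_def partial_order_on_def preorder_on_def
        intro: refl_onD)
  fix a b c :: omega1
  have antisym: "a \<le> b \<Longrightarrow> b \<le> a \<Longrightarrow> a = b" for a b :: omega1
    using anti by (auto simp: less_eq_omega1_def Rep_omega1_inject dest: antisymD)
  show "a < b \<longleftrightarrow> a \<le> b \<and> \<not> b \<le> a"
    using antisym by (auto simp: less_omega1_def less_eq_omega1_def refl Rep_omega1)
  show "a \<le> a"
    by (simp add: less_eq_omega1_def refl Rep_omega1)
  show "a \<le> b \<Longrightarrow> b \<le> c \<Longrightarrow> a \<le> c"
    using tr by (auto simp: less_eq_omega1_def dest: transD)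
  show "a \<le> b \<Longrightarrow> b \<le> a \<Longrightarrow> a = b" by (rule antisym)
  show "a \<le> b \<or> b \<le> a"
    using tot refl Rep_omega1[of a] Rep_omega1[of b]
    unfolding less_eq_omega1_def total_on_def by metis
  show "P a" if "\<And>x. (\<And>y. y < x \<Longrightarrow> P y) \<Longrightarrow> P x" for P and a :: omega1
  proof -
    have "wf (inv_image (cardSuc natLeq - Id) Rep_omega1)"
      using wf by (rule wf_inv_image)
    then have "wf {(x::omega1, y). x < y}"
      by (rule wf_subset) (auto simp: less_omega1_def less_eq_omega1_def Rep_omega1_inject)
    then show ?thesis
      by (rule wf_induct_rule) (use that in blast)
  qed
qed

end

lemma countable_iff_ordLeq_natLeq: "countable A \<longleftrightarrow> |A| \<le>o natLeq"
proof -
  have "countable A \<longleftrightarrow> |A| \<le>o |UNIV::nat set|"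
    unfolding countable_def card_of_ordLeq[symmetric] by auto
  then show ?thesis
    by (meson card_of_nat ordIso_symmetric ordLeq_ordIso_trans)
qed

lemma countable_lessThan_omega1: "countable {..<a::omega1}"
proof -
  let ?r = "cardSuc natLeq"
  have "|underS ?r (Rep_omega1 a)| <o ?r"
    by (intro card_of_underS cardSuc_natLeq Rep_omega1)
  then have "|underS ?r (Rep_omega1 a)| \<le>o natLeq"
    by (metis cardSuc_ordLeq_ordLess natLeq_Card_order card_of_Card_order)
  then have "countable (underS ?r (Rep_omega1 a))"
    by (simp add: countable_iff_ordLeq_natLeq)
  moreover have "Rep_omega1 ` {..<a} \<subseteq> underS ?r (Rep_omega1 a)"
    by (auto simp: underS_def less_omega1_def less_eq_omega1_def Rep_omega1_inject)
  ultimately have "countable (Rep_omega1 ` {..<a})"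
    by (rule countable_subset[rotated])
  then show ?thesis
    by (rule countable_image_inj_on) (auto simp: inj_on_def Rep_omega1_inject)
qed

lemma uncountable_omega1: "uncountable (UNIV :: omega1 set)"
proof
  assume "countable (UNIV :: omega1 set)"
  then have "countable (Rep_omega1 ` UNIV)" by (rule countable_image)
  then have "countable (Field (cardSuc natLeq))"
    by (metis type_definition.Rep_range type_definition_omega1)
  then have "|Field (cardSuc natLeq)| \<le>o natLeq"
    by (simp add: countable_iff_ordLeq_natLeq)
  moreover have "natLeq <o |Field (cardSuc natLeq)|"
    using cardSuc_natLeq card_of_Field_ordIso ordIso_symmetric ordLess_ordIso_trans by blast
  ultimately show False
    using not_ordLess_ordLeq by blast
qed

lemma countable_bounded_omega1:
  fixes A :: "omega1 set"
  assumes "countable A"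
  obtains b where "\<And>a. a \<in> A \<Longrightarrow> a < b"
proof (rule ccontr)
  assume "\<not> thesis"
  then have "\<exists>a\<in>A. b \<le> a" for b
    using that by (meson not_le)
  then have "UNIV = (\<Union>a\<in>A. insert a {..<a})"
    by (auto simp: le_less)
  then have "countable (UNIV :: omega1 set)"
    using assms countable_lessThan_omega1 by (metis countable_UN countable_insert)
  then show False using uncountable_omega1 by simp
qed

typedef long_ray = "UNIV \<times> {0..<1} :: (omega1 \<times> real) set"
  by (intro exI[of _ "(undefined, 0)"]) auto

instantiation long_ray :: linorder
begin

definition less_long_ray :: "long_ray \<Rightarrow> long_ray \<Rightarrow> bool" where
  "x < y \<longleftrightarrow> fst (Rep_long_ray x) < fst (Rep_long_ray y) \<or>
     fst (Rep_long_ray x) = fst (Rep_long_ray y) \<and> snd (Rep_long_ray x) < snd (Rep_long_ray y)"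

definition less_eq_long_ray :: "long_ray \<Rightarrow> long_ray \<Rightarrow> bool" where
  "x \<le> y \<longleftrightarrow> x < y \<or> x = y" for x y :: long_ray

instance
proof
  fix x y z :: long_ray
  show "x < y \<longleftrightarrow> x \<le> y \<and> \<not> y \<le> x"
    by (auto simp: less_eq_long_ray_def less_long_ray_def)
  show "x \<le> x" by (simp add: less_eq_long_ray_def)
  show "x \<le> y \<Longrightarrow> y \<le> z \<Longrightarrow> x \<le> z"
    by (auto simp: less_eq_long_ray_def less_long_ray_def)
  show "x \<le> y \<Longrightarrow> y \<le> x \<Longrightarrow> x = y"
    by (auto simp: less_eq_long_ray_def less_long_ray_def)
  show "x \<le> y \<or> y \<le> x"
    unfolding less_eq_long_ray_def less_long_ray_def
    by (metis Rep_long_ray_inject linorder_neqE prod_eq_iff)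
qed

end

instantiation long_ray :: linorder_topology
begin

definition open_long_ray :: "long_ray set \<Rightarrow> bool" where
  "open_long_ray = generate_topology (range (\<lambda>a. {..<a}) \<union> range (\<lambda>a. {a<..}))"

instance
  by standard (fact open_long_ray_def)

end

definition long_ray_of :: "omega1 \<Rightarrow> long_ray" where
  "long_ray_of \<alpha> = Abs_long_ray (\<alpha>, 0)"

definition bounded_long_ray :: "long_ray set \<Rightarrow> bool" where
  "bounded_long_ray B \<longleftrightarrow> (\<exists>\<alpha>. B \<subseteq> {..<long_ray_of \<alpha>})"

definition type_I_family :: "'a topology \<Rightarrow> (omega1 \<Rightarrow> 'a set) \<Rightarrow> bool" where
  "type_I_family X U \<longleftrightarrow>
     topspace X = (\<Union>\<alpha>. U \<alpha>) \<and>
     (\<forall>\<alpha>. openin X (U \<alpha>) \<and> Lindelof_space (subtopology X (X closure_of U \<alpha>))) \<and>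
     (\<forall>\<alpha> \<beta>. \<alpha> < \<beta> \<longrightarrow> X closure_of U \<alpha> \<subseteq> U \<beta>)"

definition type_I_space :: "'a topology \<Rightarrow> bool" where
  "type_I_space X \<longleftrightarrow>
     Hausdorff_space X \<and> \<not> Lindelof_space X \<and> (\<exists>U. type_I_family X U)"

text \<open>
  Boundedness does not depend on the family that witnesses Type I; see
  \<open>bounded_in_iff\<close>.
\<close>

definition bounded_in :: "'a topology \<Rightarrow> 'a set \<Rightarrow> bool" where
  "bounded_in X A \<longleftrightarrow> (\<exists>U \<alpha>. type_I_family X U \<and> A \<subseteq> U \<alpha>)"

lemma type_I_family_mono:
  assumes "type_I_family X U" "\<alpha> \<le> \<beta>"
  shows "U \<alpha> \<subseteq> U \<beta>"
proof (cases "\<alpha> = \<beta>")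
  case False
  then have "X closure_of U \<alpha> \<subseteq> U \<beta>" and "U \<alpha> \<subseteq> topspace X"
    using assms by (auto simp: type_I_family_def)
  then show ?thesis
    using closure_of_subset by blast
qed simp

lemma bounded_in_iff:
  assumes V: "type_I_family X V"
  shows "bounded_in X A \<longleftrightarrow> (\<exists>\<alpha>. A \<subseteq> V \<alpha>)"
proof
  assume "bounded_in X A"
  then obtain U \<alpha> where U: "type_I_family X U" and A: "A \<subseteq> U \<alpha>"
    by (auto simp: bounded_in_def)
  let ?C = "X closure_of U \<alpha>"
  let ?S = "subtopology X ?C"
  have C: "?C \<subseteq> topspace X" by (rule closure_of_subset_topspace)
  have "Lindelof_space ?S" using U by (auto simp: type_I_family_def)
  moreover have "openin ?S W" if "W \<in> range (\<lambda>\<beta>. ?C \<inter> V \<beta>)" for W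
    using that V by (auto simp: type_I_family_def intro: openin_subtopology_Int2)
  moreover have "\<Union>(range (\<lambda>\<beta>. ?C \<inter> V \<beta>)) = topspace ?S"
    using V C by (auto simp: type_I_family_def)
  ultimately obtain \<W> where W: "countable \<W>" "\<W> \<subseteq> range (\<lambda>\<beta>. ?C \<inter> V \<beta>)" "\<Union>\<W> = topspace ?S"
    by (metis Lindelof_spaceD)
  then obtain B where B: "countable B" "\<W> = (\<lambda>\<beta>. ?C \<inter> V \<beta>) ` B"
    by (metis countable_subset_image)
  obtain b where b: "\<And>a. a \<in> B \<Longrightarrow> a < b"
    using B(1) countable_bounded_omega1 by blast
  have "?C \<subseteq> V b"
  proof
    fix x assume "x \<in> ?C"
    then have "x \<in> \<Union>\<W>" using W(3) C by auto
    then obtain \<beta> where "\<beta> \<in> B" "x \<in> V \<beta>" using B(2) by auto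
    then show "x \<in> V b" using type_I_family_mono[OF V, of \<beta> b] b by (auto simp: less_imp_le)
  qed
  moreover have "U \<alpha> \<subseteq> ?C"
    using U by (intro closure_of_subset) (auto simp: type_I_family_def)
  ultimately show "\<exists>\<alpha>. A \<subseteq> V \<alpha>" using A by blast
qed (use V in \<open>auto simp: bounded_in_def\<close>)

definition club_in :: "'a topology \<Rightarrow> 'a set \<Rightarrow> bool" where
  "club_in X D \<longleftrightarrow> closedin X D \<and> \<not> bounded_in X D"

definition direction_in :: "'a topology \<Rightarrow> 'a set \<Rightarrow> bool" where
  "direction_in X D \<longleftrightarrow> club_in X D \<and>
     (\<forall>f :: 'a \<Rightarrow> long_ray. continuous_map X euclidean f \<longrightarrow> \<not> bounded_long_ray (f ` D) \<longrightarrow>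
        (\<forall>C. C \<subseteq> D \<and> club_in X C \<longrightarrow> \<not> bounded_long_ray (f ` C)))"

definition omega_bounded_space :: "'a topology \<Rightarrow> bool" where
  "omega_bounded_space X \<longleftrightarrow>
     (\<forall>A. A \<subseteq> topspace X \<and> countable A \<longrightarrow> compactin X (X closure_of A))"

text \<open>
  \<open>\<beta>\<omega>\<close> is the space of ultrafilters on \<open>\<omega>\<close>, topologised by the sets
  \<open>stone_set A\<close> of ultrafilters containing \<open>A\<close>; \<open>n\<close> is identified with the
  principal ultrafilter at \<open>n\<close>.  The lemmas below establish the defining property of the
  Cech-Stone compactification: \<open>beta_omega\<close> is a compact Hausdorff space, the principal
  ultrafilters form a dense copy of the discrete space \<open>\<omega>\<close>, and every map from \<open>\<omega>\<close>
  to a compact Hausdorff space extends continuously.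
\<close>

definition ultrafilter :: "'a filter \<Rightarrow> bool" where
  "ultrafilter F \<longleftrightarrow>
     F \<noteq> bot \<and> (\<forall>P. eventually P F \<or> eventually (\<lambda>x. \<not> P x) F)"

definition stone_set :: "'a set \<Rightarrow> 'a filter set" where
  "stone_set A = {F. ultrafilter F \<and> eventually (\<lambda>x. x \<in> A) F}"

definition beta_omega :: "nat filter topology" where
  "beta_omega = topology_generated_by (range stone_set)"

lemma topspace_beta_omega: "topspace beta_omega = {F. ultrafilter F}"
proof -
  have "{F :: nat filter. ultrafilter F} = stone_set UNIV" by (simp add: stone_set_def)
  moreover have "stone_set A \<subseteq> {F. ultrafilter F}" for A :: "nat set"
    by (auto simp: stone_set_def)
  ultimately show ?thesis
    by (auto simp: beta_omega_def)
qed

lemma openin_stone_set: "openin beta_omega (stone_set A)"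
  by (auto simp: beta_omega_def intro: topology_generated_by_Basis)

lemma ultrafilter_not_iff:
  "ultrafilter F \<Longrightarrow> eventually (\<lambda>x. \<not> P x) F \<longleftrightarrow> \<not> eventually P F"
  using eventually_conj[of P F "\<lambda>x. \<not> P x"] by (auto simp: ultrafilter_def trivial_limit_def)

lemma ultrafilter_principal: "ultrafilter (principal {n})"
  by (auto simp: ultrafilter_def eventually_principal principal_eq_bot_iff)

lemma Hausdorff_beta_omega: "Hausdorff_space beta_omega"
  unfolding Hausdorff_space_def
proof (intro allI impI, elim conjE)
  fix F G assume FG: "F \<in> topspace beta_omega" "G \<in> topspace beta_omega" "F \<noteq> G"
  then have u: "ultrafilter F" "ultrafilter G" by (auto simp: topspace_beta_omega)
  obtain P where "eventually P F \<noteq> eventually P G"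
    using FG(3) filter_eq_iff by blast
  then obtain P where P: "eventually P F" "\<not> eventually P G"
    using u ultrafilter_not_iff by metis
  have "disjnt (stone_set {n. P n}) (stone_set {n. \<not> P n})"
    using ultrafilter_not_iff by (auto simp: disjnt_def stone_set_def)
  moreover have "F \<in> stone_set {n. P n}" "G \<in> stone_set {n. \<not> P n}"
    using u P ultrafilter_not_iff by (auto simp: stone_set_def)
  ultimately show "\<exists>U V. openin beta_omega U \<and> openin beta_omega V \<and> F \<in> U \<and> G \<in> V \<and> disjnt U V"
    using openin_stone_set by blast
qed

lemma ultrafilter_extend:
  fixes F :: "'a filter"
  assumes "F \<noteq> bot"
  obtains G where "ultrafilter G" "G \<le> F"
proof -
  let ?A = "{G. G \<noteq> bot \<and> G \<le> F}"
  have "\<exists>m\<in>?A. \<forall>a\<in>?A. a \<le> m \<longrightarrow> a = m"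
  proof (rule predicate_Zorn)
    show "partial_order_on ?A (relation_of (\<lambda>x y. y \<le> x) ?A)"
      by (rule partial_order_on_relation_ofI) auto
    fix C assume C: "C \<in> Chains (relation_of (\<lambda>x y. y \<le> x) ?A)"
    show "\<exists>u\<in>?A. \<forall>a\<in>C. u \<le> a"
    proof (cases "C = {}")
      case True
      then show ?thesis using assms by auto
    next
      case False
      have ch: "a \<in> ?A" "a \<le> b \<or> b \<le> a" if "a \<in> C" "b \<in> C" for a b
        using C that by (auto simp: Chains_def relation_of_def)
      have ev: "eventually P (Inf C) \<longleftrightarrow> (\<exists>b\<in>C. eventually P b)" for P
        using False ch by (intro eventually_Inf_base) (metis inf.absorb1 inf.absorb2 order_refl)+
      have "Inf C \<noteq> bot"
        using ev ch(1) by (auto simp: trivial_limit_def)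
      moreover have "Inf C \<le> F"
        using False ch(1) by (metis (mono_tags, lifting) Inf_lower2 ex_in_conv mem_Collect_eq)
      ultimately show ?thesis by (intro bexI[of _ "Inf C"]) (auto intro: Inf_lower)
    qed
  qed
  then obtain G where G: "G \<noteq> bot" "G \<le> F" and max: "\<And>H. H \<noteq> bot \<Longrightarrow> H \<le> G \<Longrightarrow> H = G"
    by (auto intro: order_trans)
  have "ultrafilter G"
    unfolding ultrafilter_def
  proof (intro conjI allI G(1))
    fix P
    show "eventually P G \<or> eventually (\<lambda>x. \<not> P x) G"
    proof (rule disjCI)
      let ?H = "inf G (principal {x. P x})"
      assume "\<not> eventually (\<lambda>x. \<not> P x) G"
      then have "?H \<noteq> bot"
        by (simp add: trivial_limit_def eventually_inf_principal)
      then have "?H = G" using max by simp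
      moreover have "eventually P ?H" by (simp add: eventually_inf_principal)
      ultimately show "eventually P G" by simp
    qed
  qed
  then show thesis using that G(2) by blast
qed

lemma stone_set_base:
  assumes "openin beta_omega W" "F \<in> W"
  obtains A where "F \<in> stone_set A" "stone_set A \<subseteq> W"
proof -
  have "generate_topology_on (range stone_set) W"
    using assms(1) by (simp add: beta_omega_def openin_topology_generated_by_iff)
  then have "\<forall>F\<in>W. \<exists>A. F \<in> stone_set A \<and> stone_set A \<subseteq> W"
  proof induction
    case (Int a b)
    show ?case
    proof
      fix F assume "F \<in> a \<inter> b"
      then obtain A B where "F \<in> stone_set A" "stone_set A \<subseteq> a" "F \<in> stone_set B" "stone_set B \<subseteq> b"
        using Int.IH by blast
      moreover have "stone_set (A \<inter> B) = stone_set A \<inter> stone_set B"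
        by (auto simp: stone_set_def eventually_conj_iff)
      ultimately show "\<exists>A. F \<in> stone_set A \<and> stone_set A \<subseteq> a \<inter> b" by blast
    qed
  qed blast+
  then show thesis using assms(2) that by blast
qed

lemma compact_beta_omega: "compact_space beta_omega"
  unfolding compact_space_alt
proof (intro allI impI, elim conjE)
  fix \<U> assume op: "\<forall>U\<in>\<U>. openin beta_omega U" and cov: "topspace beta_omega \<subseteq> \<Union>\<U>"
  define \<A> where "\<A> = {A. \<exists>U\<in>\<U>. stone_set A \<subseteq> U}"
  let ?F = "INF A\<in>\<A>. principal (- A)"
  have "?F = bot"
  proof (rule ccontr)
    assume "?F \<noteq> bot"
    then obtain G where G: "ultrafilter G" "G \<le> ?F" by (rule ultrafilter_extend)
    then obtain U where U: "U \<in> \<U>" "G \<in> U"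
      using cov by (auto simp: topspace_beta_omega)
    then obtain A where A: "G \<in> stone_set A" "stone_set A \<subseteq> U"
      using op stone_set_base by metis
    then have "A \<in> \<A>" using U by (auto simp: \<A>_def)
    then have "G \<le> principal (- A)" using G(2) by (meson INF_lower order_trans)
    then have "eventually (\<lambda>x. x \<notin> A) G" by (simp add: le_principal)
    then show False using A(1) ultrafilter_not_iff by (auto simp: stone_set_def)
  qed
  then have "eventually (\<lambda>_. False) ?F" by (simp only: eventually_False)
  then obtain \<B> where B: "finite \<B>" "\<B> \<subseteq> \<A>" "eventually (\<lambda>_. False) (INF A\<in>\<B>. principal (- A))"
    by (blast dest: iffD1[OF eventually_INF])
  then have "(\<Inter>A\<in>\<B>. - A) = {}"
    unfolding INF_principal_finite[OF B(1)] eventually_principal by blast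
  then have UB: "\<Union>\<B> = UNIV" by auto
  have "\<forall>A\<in>\<A>. \<exists>U. U \<in> \<U> \<and> stone_set A \<subseteq> U"
    by (auto simp: \<A>_def)
  then obtain u where u: "\<forall>A\<in>\<A>. u A \<in> \<U> \<and> stone_set A \<subseteq> u A"
    by (rule bchoice[THEN exE])
  have "topspace beta_omega \<subseteq> \<Union>(u ` \<B>)"
  proof
    fix G assume "G \<in> topspace beta_omega"
    then have G: "ultrafilter G" by (simp add: topspace_beta_omega)
    have "\<exists>A\<in>\<B>. eventually (\<lambda>x. x \<in> A) G"
    proof (rule ccontr)
      assume "\<not> ?thesis"
      then have "eventually (\<lambda>x. x \<notin> A) G" if "A \<in> \<B>" for A
        using that ultrafilter_not_iff[OF G] by blast
      then have "eventually (\<lambda>x. \<forall>A\<in>\<B>. x \<notin> A) G"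
        by (intro eventually_ball_finite[OF B(1)] ballI)
      then have "eventually (\<lambda>x. False) G"
        by (rule eventually_mono) (use UB in blast)
      then show False using G by (simp add: ultrafilter_def)
    qed
    then obtain A where "A \<in> \<B>" "G \<in> stone_set A" using G by (auto simp: stone_set_def)
    then show "G \<in> \<Union>(u ` \<B>)" using u B(2) by blast
  qed
  then show "\<exists>\<F>. finite \<F> \<and> \<F> \<subseteq> \<U> \<and> topspace beta_omega \<subseteq> \<Union>\<F>"
    using B(1,2) u by (intro exI[of _ "u ` \<B>"]) blast
qed

lemma discrete_principal_beta_omega: "openin beta_omega {principal {n}}"
proof -
  have "stone_set {n} = {principal {n}}"
  proof -
    have "F = principal {n}" if "ultrafilter F" "eventually (\<lambda>x. x \<in> {n}) F" for F
    proof -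
      have "F \<le> principal {n}" using that(2) by (simp add: le_principal)
      moreover have "principal {n} \<le> F"
      proof (rule filter_leI)
        fix P assume "eventually P F"
        then have "eventually (\<lambda>x. P x \<and> x \<in> {n}) F" using that(2) by (rule eventually_conj)
        then have "eventually (\<lambda>x. P n) F" by (rule eventually_mono) simp
        then have "P n" using that(1) by (cases "P n") (simp_all add: ultrafilter_def)
        then show "eventually P (principal {n})" by (simp add: eventually_principal)
      qed
      ultimately show ?thesis by (rule antisym)
    qed
    then show ?thesis
      by (auto simp: stone_set_def ultrafilter_principal eventually_principal)
  qed
  then show ?thesis using openin_stone_set by metis
qed

lemma dense_principal_beta_omega:
  "beta_omega closure_of (range (\<lambda>n. principal {n})) = topspace beta_omega"
proof -
  have "\<exists>n. principal {n} \<in> W" if W: "openin beta_omega W" "F \<in> W" for F W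
  proof -
    obtain A where A: "F \<in> stone_set A" "stone_set A \<subseteq> W"
      using W by (rule stone_set_base)
    then have "A \<noteq> {}" by (auto simp: stone_set_def ultrafilter_def)
    then obtain n where "n \<in> A" by blast
    then have "principal {n} \<in> stone_set A"
      by (simp add: stone_set_def ultrafilter_principal eventually_principal)
    then show ?thesis using A by blast
  qed
  then show ?thesis by (fastforce simp: closure_of_def)
qed

lemma ultrafilter_limit:
  assumes "compact_space K" "ultrafilter F" "range g \<subseteq> topspace K"
  shows "\<exists>l. limitin K g l F"
proof (rule ccontr)
  assume neg: "\<not> ?thesis"
  let ?\<U> = "{U. openin K U \<and> \<not> eventually (\<lambda>x. g x \<in> U) F}"
  have "topspace K \<subseteq> \<Union>?\<U>"
    using neg by (fastforce simp: limitin_def)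
  then obtain \<F> where F: "finite \<F>" "\<F> \<subseteq> ?\<U>" "topspace K \<subseteq> \<Union>\<F>"
    using assms(1) unfolding compact_space_alt by (metis (no_types, lifting) mem_Collect_eq)
  have "eventually (\<lambda>x. g x \<notin> U) F" if "U \<in> \<F>" for U
    using F(2) that assms(2) by (auto simp: ultrafilter_not_iff)
  then have "eventually (\<lambda>x. \<forall>U\<in>\<F>. g x \<notin> U) F"
    using F(1) by (simp add: eventually_ball_finite_distrib)
  moreover have "\<not> (\<forall>U\<in>\<F>. g x \<notin> U)" for x
    using F(3) assms(3) by blast
  ultimately show False using assms(2) by (simp add: ultrafilter_def)
qed

lemma extension_beta_omega:
  fixes g :: "nat \<Rightarrow> 'a"
  assumes K: "compact_space K" "Hausdorff_space K" and g: "range g \<subseteq> topspace K"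
  shows "\<exists>h. continuous_map beta_omega K h \<and> (\<forall>n. h (principal {n}) = g n)"
proof -
  obtain h where h: "\<And>F. ultrafilter F \<Longrightarrow> limitin K g (h F) F"
    using ultrafilter_limit[OF K(1) _ g] by metis
  have hn: "h (principal {n}) = g n" for n
  proof (rule limitin_Hausdorff_unique[OF h _ _ K(2)])
    show "limitin K g (g n) (principal {n})"
      using g by (auto simp: limitin_def eventually_principal)
  qed (simp_all add: ultrafilter_principal principal_eq_bot_iff)
  have "continuous_map beta_omega K h"
    unfolding continuous_map
  proof (intro conjI allI impI)
    show "h ` topspace beta_omega \<subseteq> topspace K"
      using h by (auto simp: topspace_beta_omega limitin_def)
    fix W assume W: "openin K W"
    show "openin beta_omega {F \<in> topspace beta_omega. h F \<in> W}"
    proof (subst openin_subopen, intro ballI)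
      fix F assume "F \<in> {F \<in> topspace beta_omega. h F \<in> W}"
      then have F: "ultrafilter F" "h F \<in> W" by (auto simp: topspace_beta_omega)
      have "neighbourhood_base_of (closedin K) K"
        using K by (simp add: neighbourhood_base_of_closedin compact_Hausdorff_imp_regular_space)
      then obtain U C where UC: "openin K U" "closedin K C" "h F \<in> U" "U \<subseteq> C" "C \<subseteq> W"
        using W F(2) unfolding neighbourhood_base_of by meson
      have "F \<in> stone_set {n. g n \<in> U}"
        using h[OF F(1)] UC F(1) by (auto simp: limitin_def stone_set_def)
      moreover have "stone_set {n. g n \<in> U} \<subseteq> {F \<in> topspace beta_omega. h F \<in> W}"
      proof
        fix G assume G: "G \<in> stone_set {n. g n \<in> U}"
        then have u: "ultrafilter G" by (simp add: stone_set_def)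
        have "h G \<in> C"
        proof (rule limitin_closedin[OF h[OF u] UC(2)])
          show "eventually (\<lambda>x. g x \<in> C) G"
            using G UC(4) by (auto simp: stone_set_def elim: eventually_mono)
          show "G \<noteq> bot" using u by (simp add: ultrafilter_def)
        qed
        then show "G \<in> {F \<in> topspace beta_omega. h F \<in> W}"
          using UC(5) u by (auto simp: topspace_beta_omega)
      qed
      ultimately show "\<exists>T. openin beta_omega T \<and> F \<in> T \<and> T \<subseteq> {F \<in> topspace beta_omega. h F \<in> W}"
        using openin_stone_set by blast
    qed
  qed
  then show ?thesis using hn by blast
qed

end

theory Submission
  imports Defs
begin

text \<open>
  Take an \<open>\<omega>\<^sub>1\<close>-sequence \<open>A\<^sub>\<alpha> \<subseteq> \<omega>\<close> that strictly increases modulo finite sets, and let \<open>Q\<close> be the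
  union of the clopen subsets \<open>U\<^sub>\<alpha>\<close> of \<open>\<omega>\<^sup>*\<close> which the \<open>A\<^sub>\<alpha>\<close> determine.  Given a club \<open>D\<close>, pick
  pairs \<open>x\<^sub>\<xi> \<noteq> y\<^sub>\<xi>\<close> of points of \<open>D\<close> in pairwise disjoint blocks \<open>U\<^bsub>\<beta>\<^esub> - U\<^bsub>\<delta>\<^esub>\<close> which are cofinal in
  \<open>Q\<close>.  As countably many functions that are coherent modulo finite sets have a common extension,
  a transfinite recursion glues sets separating \<open>x\<^sub>\<xi>\<close> from \<open>y\<^sub>\<xi>\<close> to a clopen \<open>V \<subseteq> Q\<close> with
  \<open>x\<^sub>\<xi> \<in> V\<close> and \<open>y\<^sub>\<xi> \<notin> V\<close> for all \<open>\<xi>\<close>.  The rank function \<open>F \<mapsto> min {\<alpha>. F \<in> U\<^sub>\<alpha>}\<close>, replaced by the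
  constant 0 off \<open>V\<close>, is continuous, unbounded on \<open>D\<close>, and bounded on the club \<open>D - V\<close>.
\<close>

section \<open>Continuity of maps into the long ray\<close>

lemma long_ray_of_less_iff [simp]: "long_ray_of \<alpha> < long_ray_of \<beta> \<longleftrightarrow> \<alpha> < \<beta>"
  by (simp add: long_ray_of_def less_long_ray_def Abs_long_ray_inverse)

text \<open>The second coordinate of \<open>long_ray_of \<alpha>\<close> is the least possible one,
  so a tie in the first coordinates never puts \<open>a\<close> strictly below it.\<close>

lemma long_ray_less_long_ray_of_iff: "a < long_ray_of \<alpha> \<longleftrightarrow> fst (Rep_long_ray a) < \<alpha>"
  using Rep_long_ray[of a] by (auto simp: long_ray_of_def less_long_ray_def Abs_long_ray_inverse)

text \<open>All values lie on the copy of \<omega>1 in the long ray. There the preimage of an upper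
  ray is the complement of one sublevel set of \<open>g\<close>, and the preimage of a lower ray is
  a union of sublevel sets, so clopen sublevel sets suffice.\<close>

lemma continuous_map_long_ray_of:
  assumes clopen: "\<And>\<alpha>. openin X {x \<in> topspace X. g x \<le> \<alpha>}" "\<And>\<alpha>. closedin X {x \<in> topspace X. g x \<le> \<alpha>}"
  shows "continuous_map X euclidean (\<lambda>x. long_ray_of (g x))"
  unfolding continuous_map_upper_lower_semicontinuous_lt
proof (intro conjI allI)
  fix a
  let ?S = "\<lambda>\<alpha>. {x \<in> topspace X. g x \<le> \<alpha>}"
  have "{x \<in> topspace X. a < long_ray_of (g x)} = topspace X - ?S (fst (Rep_long_ray a))"
    by (auto simp: long_ray_less_long_ray_of_iff)
  then show "openin X {x \<in> topspace X. a < long_ray_of (g x)}"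
    using clopen(2) by (metis openin_diff openin_topspace)
  have "{x \<in> topspace X. long_ray_of (g x) < a} = (\<Union>\<alpha>\<in>{\<alpha>. long_ray_of \<alpha> < a}. ?S \<alpha>)"
    by (auto simp: le_less_trans) (metis le_less_trans long_ray_of_less_iff not_le)
  then show "openin X {x \<in> topspace X. long_ray_of (g x) < a}"
    using clopen(1) by (metis (no_types, lifting) imageE openin_Union)
qed

section \<open>Countable diagonalisation and almost increasing sequences of sets\<close>

lemma countable_dominated:
  fixes S :: "(nat \<Rightarrow> nat) set"
  assumes "countable S"
  shows "\<exists>g. \<forall>h\<in>S. \<forall>\<^sub>\<infinity>n. h n < g n"
proof (intro exI ballI)
  fix h assume h: "h \<in> S"
  let ?e = "from_nat_into S"
  obtain i where i: "?e i = h"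
    using from_nat_into_surj[OF assms h] by blast
  \<comment> \<open>The diagonal bound at n sums the first n + 1 enumerated functions at n, so the
    function with index i is among the summands once n passes i.\<close>
  have "h n < Suc (\<Sum>j\<le>n. ?e j n)" if "n > i" for n
    using member_le_sum[of i "{..n}" "\<lambda>j. ?e j n"] that i by simp
  then show "\<forall>\<^sub>\<infinity>n. h n < Suc (\<Sum>j\<le>n. ?e j n)"
    unfolding MOST_nat by blast
qed

text \<open>At n the glued function follows the first index in the enumeration of \<open>I\<close>
  whose domain \<open>F\<close> contains n. On \<open>F i\<close>, with i enumerated as number m,
  only the indices up to m can be selected, and each of them disagrees with \<open>e i\<close> at
  finitely many points of the common domain. Values outside all domains are irrelevant.\<close>

lemma countable_coherent_glue:
  fixes e :: "'i \<Rightarrow> 'a \<Rightarrow> 'b"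
  assumes I: "countable I"
    and coh: "\<And>i j. i \<in> I \<Longrightarrow> j \<in> I \<Longrightarrow> \<forall>\<^sub>\<infinity>n. n \<in> F i \<longrightarrow> n \<in> F j \<longrightarrow> e i n = e j n"
  shows "\<exists>r. \<forall>i\<in>I. \<forall>\<^sub>\<infinity>n. n \<in> F i \<longrightarrow> r n = e i n"
proof (intro exI ballI)
  fix i assume i: "i \<in> I"
  let ?k = "from_nat_into I"
  let ?l = "\<lambda>n. LEAST m. n \<in> F (?k m)"
  obtain m where m: "?k m = i"
    using from_nat_into_surj[OF I i] by blast
  have "\<forall>\<^sub>\<infinity>n. \<forall>l\<in>{..m}. n \<in> F (?k l) \<longrightarrow> n \<in> F i \<longrightarrow> e (?k l) n = e i n"
    using i by (intro eventually_ball_finite ballI coh from_nat_into) auto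
  then show "\<forall>\<^sub>\<infinity>n. n \<in> F i \<longrightarrow> e (?k (?l n)) n = e i n"
  proof (rule eventually_mono, intro impI)
    fix n assume n: "\<forall>l\<in>{..m}. n \<in> F (?k l) \<longrightarrow> n \<in> F i \<longrightarrow> e (?k l) n = e i n" "n \<in> F i"
    have "n \<in> F (?k (?l n))" "?l n \<le> m"
      using n(2) m by (auto intro: LeastI Least_le)
    then show "e (?k (?l n)) n = e i n"
      using n by auto
  qed
qed

lemma exists_dominating_sequence:
  "\<exists>f :: omega1 \<Rightarrow> nat \<Rightarrow> nat. \<forall>\<alpha>. \<forall>\<beta><\<alpha>. \<forall>\<^sub>\<infinity>n. f \<beta> n < f \<alpha> n"
proof (rule dependent_wellorder_choice)
  fix \<alpha> :: omega1 and f :: "omega1 \<Rightarrow> nat \<Rightarrow> nat"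
  show "\<exists>r. \<forall>\<beta><\<alpha>. \<forall>\<^sub>\<infinity>n. f \<beta> n < r n"
    using countable_dominated[of "f ` {..<\<alpha>}"] countable_lessThan_omega1 by auto
qed auto

text \<open>The clause \<open>strict\<close> is what keeps \<open>Q\<close> from being exhausted by
  a single \<open>U \<alpha>\<close>: an infinite difference carries a free ultrafilter.\<close>

locale almost_increasing =
  fixes A :: "omega1 \<Rightarrow> nat set"
  assumes almost_subset: "\<alpha> \<le> \<beta> \<Longrightarrow> \<forall>\<^sub>\<infinity>n. n \<in> A \<alpha> \<longrightarrow> n \<in> A \<beta>"
    and strict: "\<alpha> < \<beta> \<Longrightarrow> \<exists>\<^sub>\<infinity>n. n \<in> A \<beta> \<and> n \<notin> A \<alpha>"

text \<open>The set \<open>A \<alpha>\<close> codes the region below the graph of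
  \<open>f \<alpha>\<close>. Inclusion can fail only in the finitely many columns where domination
  fails, and each column is finite. The points of the larger graph in the remaining columns witness
  strictness.\<close>

lemma exists_almost_increasing: "\<exists>A. almost_increasing A"
proof -
  obtain f :: "omega1 \<Rightarrow> nat \<Rightarrow> nat" where f: "\<And>\<alpha> \<beta>. \<beta> < \<alpha> \<Longrightarrow> \<forall>\<^sub>\<infinity>n. f \<beta> n < f \<alpha> n"
    using exists_dominating_sequence by metis
  define A where "A \<alpha> = prod_encode ` (SIGMA m:UNIV. {..f \<alpha> m})" for \<alpha>
  have A_iff: "prod_encode (m, k) \<in> A \<alpha> \<longleftrightarrow> k \<le> f \<alpha> m" for m k \<alpha>
    by (auto simp: A_def image_iff)
  have "almost_increasing A"
  proof
    fix \<alpha> \<beta> :: omega1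
    show "\<forall>\<^sub>\<infinity>n. n \<in> A \<alpha> \<longrightarrow> n \<in> A \<beta>" if le: "\<alpha> \<le> \<beta>"
    proof (cases "\<alpha> = \<beta>")
      case False
      then obtain M where M: "\<And>m. m > M \<Longrightarrow> f \<alpha> m < f \<beta> m"
        using f[of \<alpha> \<beta>] le unfolding MOST_nat by (meson le_neq_trans)
      have "{n. \<not> (n \<in> A \<alpha> \<longrightarrow> n \<in> A \<beta>)} \<subseteq> prod_encode ` (SIGMA m:{..M}. {..f \<alpha> m})"
      proof
        fix n assume n: "n \<in> {n. \<not> (n \<in> A \<alpha> \<longrightarrow> n \<in> A \<beta>)}"
        obtain m k where mk: "n = prod_encode (m, k)"
          by (metis prod_decode_inverse surj_pair)
        then have "k \<le> f \<alpha> m" "\<not> k \<le> f \<beta> m"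
          using n by (auto simp: A_iff)
        then have "m \<le> M"
          using M[of m] by linarith
        then show "n \<in> prod_encode ` (SIGMA m:{..M}. {..f \<alpha> m})"
          using mk \<open>k \<le> f \<alpha> m\<close> by auto
      qed
      then show ?thesis
        unfolding eventually_cofinite by (rule finite_subset) auto
    qed simp
    show "\<exists>\<^sub>\<infinity>n. n \<in> A \<beta> \<and> n \<notin> A \<alpha>" if less: "\<alpha> < \<beta>"
    proof -
      obtain M where M: "\<And>m. m > M \<Longrightarrow> f \<alpha> m < f \<beta> m"
        using f[OF less] by (auto simp: MOST_nat)
      have "infinite ((\<lambda>m. prod_encode (m, f \<beta> m)) ` {M<..})"
        by (subst finite_image_iff) (auto simp: inj_on_def infinite_Ioi)
      moreover have "(\<lambda>m. prod_encode (m, f \<beta> m)) ` {M<..} \<subseteq> {n. n \<in> A \<beta> \<and> n \<notin> A \<alpha>}"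
        using M by (fastforce simp: A_iff not_le)
      ultimately show ?thesis
        unfolding frequently_cofinite by (metis finite_subset)
    qed
  qed
  then show ?thesis by blast
qed

section \<open>The subspace \<open>Q\<close> of free ultrafilters and its exhaustion by compact open
  sets\<close>

context almost_increasing
begin

text \<open>Requiring \<open>F \<le> cofinite\<close> discards the principal ultrafilters. A free
  ultrafilter ignores finite changes, so the almost inclusions between the \<open>A \<alpha>\<close>
  become true inclusions between the \<open>U \<alpha>\<close>.\<close>

definition Q :: "nat filter set" where
  "Q = {F. ultrafilter F \<and> F \<le> cofinite \<and> (\<exists>\<alpha>. \<forall>\<^sub>F n in F. n \<in> A \<alpha>)}"

definition U :: "omega1 \<Rightarrow> nat filter set" where
  "U \<alpha> = {F \<in> Q. \<forall>\<^sub>F n in F. n \<in> A \<alpha>}"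

definition rank :: "nat filter \<Rightarrow> omega1" where
  "rank F = (LEAST \<alpha>. F \<in> U \<alpha>)"

abbreviation X :: "nat filter topology" where
  "X \<equiv> subtopology beta_omega Q"

lemma Q_D: "F \<in> Q \<Longrightarrow> ultrafilter F" "F \<in> Q \<Longrightarrow> (\<forall>\<^sub>\<infinity>n. P n) \<Longrightarrow> eventually P F"
  by (auto simp: Q_def filter_leD)

lemma Q_subset: "Q \<subseteq> topspace beta_omega"
  by (auto simp: Q_def topspace_beta_omega)

lemma topspace_Int_Q [simp]: "topspace beta_omega \<inter> Q = Q"
  using Q_subset by blast

lemma U_mono: "\<alpha> \<le> \<beta> \<Longrightarrow> U \<alpha> \<subseteq> U \<beta>"
proof
  fix F assume le: "\<alpha> \<le> \<beta>" and F: "F \<in> U \<alpha>"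
  then have "\<forall>\<^sub>F n in F. n \<in> A \<alpha> \<longrightarrow> n \<in> A \<beta>"
    using Q_D(2)[OF _ almost_subset[OF le]] by (simp add: U_def)
  then show "F \<in> U \<beta>"
    using F by (auto simp: U_def elim: eventually_elim2)
qed

lemma Union_U: "(\<Union>\<alpha>. U \<alpha>) = Q"
  by (auto simp: U_def Q_def)

lemma U_subset: "U \<alpha> \<subseteq> Q"
  by (auto simp: U_def)

lemma openin_X_stone: "openin X (Q \<inter> stone_set B)"
  by (simp add: openin_stone_set openin_subtopology_Int2)

lemma U_eq_stone: "U \<alpha> = Q \<inter> stone_set (A \<alpha>)"
  by (auto simp: U_def stone_set_def Q_D(1))

lemma openin_U: "openin X (U \<alpha>)"
  unfolding U_eq_stone by (rule openin_X_stone)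

text \<open>An ultrafilter is free exactly when it contains no singleton. Hence the complement of
  \<open>U \<alpha>\<close> in the compact space \<open>beta_omega\<close> is a union of basic open
  sets.\<close>

lemma compactin_U: "compactin X (U \<alpha>)"
proof -
  have "F \<le> cofinite \<longleftrightarrow> (\<forall>k. F \<notin> stone_set {k})" if "ultrafilter F" for F :: "nat filter"
  proof
    assume F: "F \<le> cofinite"
    have "\<forall>\<^sub>F n in F. n \<notin> {k}" for k
      by (rule filter_leD[OF F]) (simp add: eventually_cofinite)
    then show "\<forall>k. F \<notin> stone_set {k}"
      using ultrafilter_not_iff[OF that] by (auto simp: stone_set_def)
  next
    assume *: "\<forall>k. F \<notin> stone_set {k}"
    show "F \<le> cofinite"
    proof (rule filter_leI)
      fix P :: "nat \<Rightarrow> bool" assume "\<forall>\<^sub>\<infinity>n. P n"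
      then have "\<forall>\<^sub>F n in F. \<forall>k\<in>{k. \<not> P k}. n \<noteq> k"
        using * that by (intro eventually_ball_finite)
          (auto simp: eventually_cofinite stone_set_def ultrafilter_not_iff)
      then show "eventually P F" by (rule eventually_mono) auto
    qed
  qed
  then have "U \<alpha> = topspace beta_omega - (stone_set (- A \<alpha>) \<union> (\<Union>k. stone_set {k}))"
    by (auto simp: U_def Q_def topspace_beta_omega stone_set_def ultrafilter_not_iff)
  moreover have "openin beta_omega (\<Union>k. stone_set {k})"
    using openin_stone_set by blast
  ultimately have "closedin beta_omega (U \<alpha>)"
    by (simp only: closedin_diff closedin_topspace openin_Un openin_stone_set)
  then show ?thesis
    using compact_beta_omega U_subset by (auto simp: compactin_subtopology closedin_compact_space)
qed

lemma Hausdorff_X: "Hausdorff_space X"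
  by (rule Hausdorff_space_subtopology[OF Hausdorff_beta_omega])

lemma closedin_U: "closedin X (U \<alpha>)"
  using compactin_U Hausdorff_X by (rule compactin_imp_closedin[rotated])

text \<open>For a later index \<beta>, any ultrafilter refining \<open>?G\<close> is free and
  contains \<open>A \<beta> - A \<alpha>\<close>; \<open>?G\<close> is proper because this
  difference is infinite.\<close>

lemma not_U_bounded: "\<not> Q \<subseteq> U \<alpha>"
proof -
  obtain \<beta> where "\<alpha> < \<beta>"
    using countable_bounded_omega1[of "{\<alpha>}"] by auto
  let ?G = "inf cofinite (principal (A \<beta> - A \<alpha>))"
  have "?G \<noteq> bot"
  proof
    assume "?G = bot"
    then have "\<forall>\<^sub>\<infinity>n. n \<notin> A \<beta> - A \<alpha>"
      by (simp add: trivial_limit_def eventually_inf_principal)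
    then show False
      using strict[OF \<open>\<alpha> < \<beta>\<close>] by (simp add: frequently_def)
  qed
  then obtain F where F: "ultrafilter F" "F \<le> ?G"
    by (rule ultrafilter_extend)
  then have "F \<le> cofinite" and "\<forall>\<^sub>F n in F. n \<in> A \<beta> - A \<alpha>"
    by (auto simp: le_principal)
  then have "\<forall>\<^sub>F n in F. n \<in> A \<beta>" "\<forall>\<^sub>F n in F. n \<notin> A \<alpha>"
    by (auto elim: eventually_mono)
  then have "F \<in> Q" "F \<notin> U \<alpha>"
    using F \<open>F \<le> cofinite\<close> ultrafilter_not_iff by (auto simp: Q_def U_def)
  then show ?thesis by blast
qed

lemma countable_subset_U:
  assumes "countable B" "B \<subseteq> Q"
  obtains \<alpha> where "B \<subseteq> U \<alpha>"
proof -
  have "\<forall>F\<in>B. \<exists>\<alpha>. F \<in> U \<alpha>"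
    using assms(2) Union_U by blast
  then obtain a where a: "\<And>F. F \<in> B \<Longrightarrow> F \<in> U (a F)"
    by metis
  obtain b where "\<And>F. F \<in> B \<Longrightarrow> a F < b"
    using countable_bounded_omega1[of "a ` B"] assms(1) by (metis countable_image image_eqI)
  then have "B \<subseteq> U b"
    using a U_mono less_imp_le by blast
  then show thesis by (rule that)
qed

lemma type_I_family_U: "type_I_family X U"
  unfolding type_I_family_def
proof (intro conjI allI impI)
  fix \<alpha> \<beta> :: omega1
  show "topspace X = (\<Union>\<alpha>. U \<alpha>)" by (simp add: Union_U)
  show "openin X (U \<alpha>)" by (rule openin_U)
  have cl: "X closure_of U \<alpha> = U \<alpha>"
    by (simp add: closure_of_eq closedin_U)
  show "Lindelof_space (subtopology X (X closure_of U \<alpha>))"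
    unfolding cl using compactin_U by (intro compact_imp_Lindelof_space compact_space_subtopology)
  show "\<alpha> < \<beta> \<Longrightarrow> X closure_of U \<alpha> \<subseteq> U \<beta>"
    unfolding cl by (simp add: U_mono)
qed

lemma not_Lindelof_X: "\<not> Lindelof_space X"
proof
  assume "Lindelof_space X"
  then obtain \<V> where V: "countable \<V>" "\<V> \<subseteq> range U" "\<Union>\<V> = Q"
    using Lindelof_spaceD[of X "range U"] openin_U Union_U by force
  then obtain B where B: "countable B" "\<V> = U ` B"
    by (metis countable_subset_image)
  obtain b where b: "\<And>a. a \<in> B \<Longrightarrow> a < b"
    using countable_bounded_omega1[OF B(1)] by blast
  have "Q \<subseteq> U b"
    using V(3) B(2) U_mono b less_imp_le by blast
  then show False using not_U_bounded by blast
qed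

lemma type_I_X: "type_I_space X"
  using Hausdorff_X not_Lindelof_X type_I_family_U by (auto simp: type_I_space_def)

text \<open>Countably many points lie in one \<open>U \<alpha>\<close>, which is compact and closed
  and so also contains their closure.\<close>

lemma omega_bounded_X: "omega_bounded_space X"
  unfolding omega_bounded_space_def
proof (intro allI impI, elim conjE)
  fix B assume "B \<subseteq> topspace X" "countable B"
  then obtain \<alpha> where "B \<subseteq> U \<alpha>"
    using countable_subset_U by auto
  then have "X closure_of B \<subseteq> U \<alpha>"
    using closedin_U by (rule closure_of_minimal)
  then show "compactin X (X closure_of B)"
    using closed_compactin[OF compactin_U] by simp
qed

lemma bounded_in_X_iff: "bounded_in X D \<longleftrightarrow> (\<exists>\<alpha>. D \<subseteq> U \<alpha>)"
  by (rule bounded_in_iff[OF type_I_family_U])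

lemma rank_le_iff:
  assumes "F \<in> Q"
  shows "rank F \<le> \<alpha> \<longleftrightarrow> F \<in> U \<alpha>"
proof
  have "F \<in> U (rank F)"
    unfolding rank_def using assms Union_U by (metis LeastI UN_iff)
  then show "rank F \<le> \<alpha> \<Longrightarrow> F \<in> U \<alpha>"
    using U_mono by blast
qed (simp add: rank_def Least_le)

section \<open>Splitting an unbounded set by a clopen set\<close>

lemma unbounded_pairs:
  assumes D: "D \<subseteq> Q" "\<not> bounded_in X D"
  shows "\<exists>\<beta> x y. \<alpha> \<le> \<beta> \<and> x \<noteq> y \<and> x \<in> D \<inter> U \<beta> - U \<alpha> \<and> y \<in> D \<inter> U \<beta> - U \<alpha>"
proof -
  have ex: "\<exists>x. x \<in> D - U \<gamma>" for \<gamma>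
    using D(2) by (auto simp: bounded_in_X_iff)
  obtain x where x: "x \<in> D - U \<alpha>"
    using ex by blast
  obtain \<gamma> where \<gamma>: "x \<in> U \<gamma>"
    using x D(1) Union_U by blast
  \<comment> \<open>Leaving \<open>U \<gamma>\<close>, which contains x, forces y to differ from
    x.\<close>
  obtain y where y: "y \<in> D - U (max \<alpha> \<gamma>)"
    using ex by blast
  obtain \<beta> where \<beta>: "y \<in> U \<beta>"
    using y D(1) Union_U by blast
  have "x \<noteq> y" "y \<notin> U \<alpha>"
    using \<gamma> y U_mono[of \<gamma> "max \<alpha> \<gamma>"] U_mono[of \<alpha> "max \<alpha> \<gamma>"] by auto
  moreover have "x \<in> U (max \<alpha> (max \<beta> \<gamma>))" "y \<in> U (max \<alpha> (max \<beta> \<gamma>))"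
    using \<gamma> \<beta> U_mono[of \<gamma> "max \<alpha> (max \<beta> \<gamma>)"] U_mono[of \<beta> "max \<alpha> (max \<beta> \<gamma>)"]
    by (auto simp: max.coboundedI2)
  ultimately show ?thesis
    using x y by (intro exI[of _ "max \<alpha> (max \<beta> \<gamma>)"] exI[of _ x] exI[of _ y]) auto
qed

text \<open>At stage \<eta> the countably many earlier functions are glued, and the result is
  overwritten by \<open>b \<eta>\<close> on the new block. This preserves coherence: for \<xi> <
  \<eta> the set \<open>A (\<beta> \<xi>)\<close> is almost contained in
  \<open>A (\<delta> \<eta>)\<close>, so it meets the block in a finite set.\<close>

lemma coherent_extension:
  fixes \<delta> \<beta> :: "omega1 \<Rightarrow> omega1" and b :: "omega1 \<Rightarrow> nat \<Rightarrow> bool"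
  assumes le: "\<And>\<xi> \<eta>. \<xi> < \<eta> \<Longrightarrow> \<beta> \<xi> \<le> \<delta> \<eta>"
  shows "\<exists>e. \<forall>\<eta>. (\<forall>\<xi><\<eta>. \<forall>\<^sub>\<infinity>n. n \<in> A (\<beta> \<xi>) \<longrightarrow> e \<eta> n = e \<xi> n) \<and>
    (\<forall>n. n \<in> A (\<beta> \<eta>) - A (\<delta> \<eta>) \<longrightarrow> e \<eta> n = b \<eta> n)"
proof (rule dependent_wellorder_choice)
  fix \<eta> :: omega1 and e :: "omega1 \<Rightarrow> nat \<Rightarrow> bool"
  assume IH: "\<And>\<zeta>. \<zeta> < \<eta> \<Longrightarrow> (\<forall>\<xi><\<zeta>. \<forall>\<^sub>\<infinity>n. n \<in> A (\<beta> \<xi>) \<longrightarrow> e \<zeta> n = e \<xi> n) \<and>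
    (\<forall>n. n \<in> A (\<beta> \<zeta>) - A (\<delta> \<zeta>) \<longrightarrow> e \<zeta> n = b \<zeta> n)"
  have "\<exists>r. \<forall>\<xi>\<in>{..<\<eta>}. \<forall>\<^sub>\<infinity>n. n \<in> A (\<beta> \<xi>) \<longrightarrow> r n = e \<xi> n"
  proof (rule countable_coherent_glue[OF countable_lessThan_omega1])
    fix \<xi> \<zeta> assume "\<xi> \<in> {..<\<eta>}" "\<zeta> \<in> {..<\<eta>}"
    then consider "\<xi> = \<zeta>" | "\<forall>\<^sub>\<infinity>n. n \<in> A (\<beta> \<xi>) \<longrightarrow> e \<zeta> n = e \<xi> n" | "\<forall>\<^sub>\<infinity>n. n \<in> A (\<beta> \<zeta>) \<longrightarrow> e \<xi> n = e \<zeta> n"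
      using IH by (metis lessThan_iff linorder_neqE)
    then show "\<forall>\<^sub>\<infinity>n. n \<in> A (\<beta> \<xi>) \<longrightarrow> n \<in> A (\<beta> \<zeta>) \<longrightarrow> e \<xi> n = e \<zeta> n"
      by cases (auto elim: eventually_mono)
  qed
  then obtain r where r: "\<And>\<xi>. \<xi> < \<eta> \<Longrightarrow> \<forall>\<^sub>\<infinity>n. n \<in> A (\<beta> \<xi>) \<longrightarrow> r n = e \<xi> n"
    by auto
  let ?r = "\<lambda>n. if n \<in> A (\<beta> \<eta>) - A (\<delta> \<eta>) then b \<eta> n else r n"
  have "\<forall>\<^sub>\<infinity>n. n \<in> A (\<beta> \<xi>) \<longrightarrow> ?r n = e \<xi> n" if "\<xi> < \<eta>" for \<xi>
    using r[OF that] almost_subset[OF le[OF that]] by eventually_elim auto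
  then show "\<exists>r. (\<forall>\<xi><\<eta>. \<forall>\<^sub>\<infinity>n. n \<in> A (\<beta> \<xi>) \<longrightarrow> r n = e \<xi> n) \<and>
    (\<forall>n. n \<in> A (\<beta> \<eta>) - A (\<delta> \<eta>) \<longrightarrow> r n = b \<eta> n)"
    by (intro exI[of _ ?r]) auto
qed auto

lemma clopen_splitting:
  assumes D: "D \<subseteq> Q" "\<not> bounded_in X D"
  obtains V where "openin X V" "closedin X V" "\<not> bounded_in X (D \<inter> V)" "\<not> bounded_in X (D - V)"
proof -
  obtain \<gamma> x y where *: "\<alpha> \<le> \<gamma> \<alpha>" "x \<alpha> \<noteq> y \<alpha>"
      "x \<alpha> \<in> D \<inter> U (\<gamma> \<alpha>) - U \<alpha>" "y \<alpha> \<in> D \<inter> U (\<gamma> \<alpha>) - U \<alpha>" for \<alpha>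
    using unbounded_pairs[OF D] by metis
  \<comment> \<open>Each \<open>\<delta> \<eta>\<close> jumps past the upper ends of all earlier
    blocks, which makes the blocks \<open>U (\<gamma> (\<delta> \<xi>)) - U (\<delta> \<xi>)\<close>
    pairwise disjoint.\<close>
  have "\<exists>\<delta> :: omega1 \<Rightarrow> omega1. \<forall>\<eta>. \<forall>\<xi><\<eta>. \<gamma> (\<delta> \<xi>) < \<delta> \<eta>"
  proof (rule dependent_wellorder_choice)
    fix \<eta> :: omega1 and \<delta> :: "omega1 \<Rightarrow> omega1"
    show "\<exists>r. \<forall>\<xi><\<eta>. \<gamma> (\<delta> \<xi>) < r"
      using countable_bounded_omega1[of "(\<lambda>\<xi>. \<gamma> (\<delta> \<xi>)) ` {..<\<eta>}"] countable_lessThan_omega1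
      by (metis countable_image image_eqI lessThan_iff)
  qed auto
  then obtain \<delta> :: "omega1 \<Rightarrow> omega1" where \<delta>: "\<And>\<xi> \<eta>. \<xi> < \<eta> \<Longrightarrow> \<gamma> (\<delta> \<xi>) < \<delta> \<eta>"
    by metis
  define \<beta> where "\<beta> \<xi> = \<gamma> (\<delta> \<xi>)" for \<xi>
  define p q where "p \<xi> = x (\<delta> \<xi>)" and "q \<xi> = y (\<delta> \<xi>)" for \<xi>
  have le: "\<xi> < \<eta> \<Longrightarrow> \<beta> \<xi> \<le> \<delta> \<eta>" and pq: "p \<xi> \<noteq> q \<xi>"
      "p \<xi> \<in> D \<inter> U (\<beta> \<xi>) - U (\<delta> \<xi>)" "q \<xi> \<in> D \<inter> U (\<beta> \<xi>) - U (\<delta> \<xi>)" for \<xi> \<eta>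
    using * \<delta> by (auto simp: \<beta>_def p_def q_def less_imp_le)
  \<comment> \<open>Cofinality of \<delta> is needed twice: the sets
    \<open>U (\<beta> \<xi>)\<close> then cover \<open>Q\<close>, and the chosen points escape every
    \<open>U \<alpha>\<close>.\<close>
  have \<delta>_ge: "\<xi> \<le> \<delta> \<xi>" for \<xi>
  proof (induction \<xi> rule: less_induct)
    case (less \<xi>)
    then have "\<zeta> < \<delta> \<xi>" if "\<zeta> < \<xi>" for \<zeta>
      using \<delta>[OF that] *(1)[of "\<delta> \<zeta>"] that by (meson le_less_trans)
    then show ?case by (meson not_le order_less_irrefl)
  qed
  have "\<exists>b. eventually b (p \<xi>) \<and> \<not> eventually b (q \<xi>)" for \<xi>
  proof -
    obtain P where "eventually P (p \<xi>) \<noteq> eventually P (q \<xi>)"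
      using pq(1) filter_eq_iff by blast
    moreover have "ultrafilter (p \<xi>)" "ultrafilter (q \<xi>)"
      using pq(2,3) D(1) Q_D(1) by auto
    ultimately show ?thesis
      using ultrafilter_not_iff by metis
  qed
  then obtain b where b: "\<And>\<xi>. eventually (b \<xi>) (p \<xi>)" "\<And>\<xi>. \<not> eventually (b \<xi>) (q \<xi>)"
    by metis
  obtain e where e: "\<And>\<xi> \<eta>. \<xi> < \<eta> \<Longrightarrow> \<forall>\<^sub>\<infinity>n. n \<in> A (\<beta> \<xi>) \<longrightarrow> e \<eta> n = e \<xi> n"
      "\<And>\<eta> n. n \<in> A (\<beta> \<eta>) - A (\<delta> \<eta>) \<Longrightarrow> e \<eta> n = b \<eta> n"
    using coherent_extension[of \<beta> \<delta> b] le by metis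
  have coh: "\<forall>\<^sub>\<infinity>n. n \<in> A (\<beta> \<xi>) \<longrightarrow> n \<in> A (\<beta> \<eta>) \<longrightarrow> e \<eta> n = e \<xi> n" for \<xi> \<eta>
  proof (cases \<xi> \<eta> rule: linorder_cases)
    case less
    from e(1)[OF this] show ?thesis by eventually_elim simp
  next
    case greater
    from e(1)[OF this] show ?thesis by eventually_elim simp
  qed simp
  \<comment> \<open>Each \<open>e \<xi>\<close> cuts \<open>U (\<beta> \<xi>)\<close> into two open
    pieces. By coherence modulo finite sets the cuts agree on free ultrafilters, so \<open>V\<close>
    and \<open>W\<close> are complementary open sets and \<open>V\<close> is clopen.\<close>
  define V where "V = (\<Union>\<xi>. Q \<inter> stone_set {n \<in> A (\<beta> \<xi>). e \<xi> n})"
  define W where "W = (\<Union>\<xi>. Q \<inter> stone_set {n \<in> A (\<beta> \<xi>). \<not> e \<xi> n})"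
  have disj: "V \<inter> W = {}"
  proof (rule ccontr)
    assume "V \<inter> W \<noteq> {}"
    then obtain F \<xi> \<eta> where F: "F \<in> Q" "\<forall>\<^sub>F n in F. n \<in> A (\<beta> \<xi>) \<and> e \<xi> n" "\<forall>\<^sub>F n in F. n \<in> A (\<beta> \<eta>) \<and> \<not> e \<eta> n"
      by (auto simp: V_def W_def stone_set_def)
    from Q_D(2)[OF F(1) coh[of \<xi> \<eta>]] F(2,3) have "\<forall>\<^sub>F n in F. False"
      by eventually_elim auto
    then show False
      using Q_D(1)[OF F(1)] by (simp add: ultrafilter_def)
  qed
  have un: "V \<union> W = Q"
  proof -
    have "F \<in> V \<union> W" if F: "F \<in> Q" for F
    proof -
      obtain \<xi> where "F \<in> U \<xi>" using F Union_U by blast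
      moreover have "\<xi> \<le> \<beta> \<xi>"
        using \<delta>_ge[of \<xi>] *(1)[of "\<delta> \<xi>"] by (simp add: \<beta>_def)
      ultimately have "\<forall>\<^sub>F n in F. n \<in> A (\<beta> \<xi>)"
        using U_mono by (auto simp: U_def)
      moreover have "eventually (e \<xi>) F \<or> (\<forall>\<^sub>F n in F. \<not> e \<xi> n)"
        using Q_D(1)[OF F] by (simp add: ultrafilter_def)
      ultimately have "(\<forall>\<^sub>F n in F. n \<in> A (\<beta> \<xi>) \<and> e \<xi> n) \<or> (\<forall>\<^sub>F n in F. n \<in> A (\<beta> \<xi>) \<and> \<not> e \<xi> n)"
        by (auto simp: eventually_conj_iff)
      then show ?thesis
        using F Q_D(1)[OF F] by (auto simp: V_def W_def stone_set_def)
    qed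
    moreover have "V \<union> W \<subseteq> Q"
      by (auto simp: V_def W_def)
    ultimately show ?thesis by blast
  qed
  have op: "openin X V" "openin X W"
    unfolding V_def W_def by (intro openin_Union; use openin_X_stone in blast)+
  have pV: "p \<xi> \<in> V" and qW: "q \<xi> \<in> W" for \<xi>
  proof -
    \<comment> \<open>An ultrafilter in the block contains
      \<open>A (\<beta> \<xi>) - A (\<delta> \<xi>)\<close>, where \<open>e \<xi>\<close> equals the
      prescribed \<open>b \<xi>\<close>; so \<open>b \<xi>\<close> decides on which side it
      falls.\<close>
    have block: "F \<in> Q" "ultrafilter F" "\<forall>\<^sub>F n in F. n \<in> A (\<beta> \<xi>) \<and> e \<xi> n = b \<xi> n"
      if "F \<in> D \<inter> U (\<beta> \<xi>) - U (\<delta> \<xi>)" for F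
    proof -
      show F: "F \<in> Q" "ultrafilter F"
        using that D(1) Q_D(1) by auto
      have "\<forall>\<^sub>F n in F. n \<in> A (\<beta> \<xi>)" "\<forall>\<^sub>F n in F. n \<notin> A (\<delta> \<xi>)"
        using that F by (auto simp: U_def ultrafilter_not_iff)
      then show "\<forall>\<^sub>F n in F. n \<in> A (\<beta> \<xi>) \<and> e \<xi> n = b \<xi> n"
        by eventually_elim (use e(2) in auto)
    qed
    have "\<forall>\<^sub>F n in p \<xi>. n \<in> A (\<beta> \<xi>) \<and> e \<xi> n"
      using block(3)[OF pq(2)] b(1) by eventually_elim simp
    then show "p \<xi> \<in> V"
      using block(1,2)[OF pq(2)] by (auto simp: V_def stone_set_def)
    have "\<forall>\<^sub>F n in q \<xi>. \<not> b \<xi> n"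
      using b(2) ultrafilter_not_iff[OF block(2)[OF pq(3)]] by blast
    with block(3)[OF pq(3)] have "\<forall>\<^sub>F n in q \<xi>. n \<in> A (\<beta> \<xi>) \<and> \<not> e \<xi> n"
      by eventually_elim simp
    then show "q \<xi> \<in> W"
      using block(1,2)[OF pq(3)] by (auto simp: W_def stone_set_def)
  qed
  \<comment> \<open>If \<open>B\<close> were inside \<open>U \<alpha>\<close>, the point
    \<open>r \<alpha>\<close> would lie in \<open>U (\<delta> \<alpha>)\<close>, because \<alpha> is
    at most \<open>\<delta> \<alpha>\<close>.\<close>
  have "\<not> bounded_in X B" if "\<And>\<xi>. r \<xi> \<in> B - U (\<delta> \<xi>)" for B r
    using that \<delta>_ge U_mono unfolding bounded_in_X_iff by blast
  from this[of p "D \<inter> V"] this[of q "D - V"]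
  have "\<not> bounded_in X (D \<inter> V)" "\<not> bounded_in X (D - V)"
    using pq(2,3) pV qW disj by (simp_all, blast)
  moreover have "closedin X V"
  proof -
    have "topspace X - W = V" using disj un by auto
    then show ?thesis using op(2) by (metis closedin_diff closedin_topspace)
  qed
  ultimately show thesis using op(1) that by blast
qed

section \<open>Refuting the direction property\<close>

lemma not_direction_in_X: "\<not> direction_in X D"
proof
  assume dir: "direction_in X D"
  then have D: "closedin X D" "\<not> bounded_in X D"
    by (auto simp: direction_in_def club_in_def)
  then have "D \<subseteq> Q"
    using closedin_subset by fastforce
  with D(2) obtain V where V: "openin X V" "closedin X V"
      "\<not> bounded_in X (D \<inter> V)" "\<not> bounded_in X (D - V)"
    by (metis clopen_splitting)
  \<comment> \<open>With the least element of \<omega>1 as the value off \<open>V\<close>, every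
    sublevel set of \<open>g\<close> contains the whole complement of \<open>V\<close> and equals
    the clopen set \<open>U \<alpha> \<union> (topspace X - V)\<close>.\<close>
  define z :: omega1 where "z = (LEAST \<alpha>. True)"
  have z: "z \<le> \<alpha>" for \<alpha>
    by (simp add: z_def Least_le)
  define g where "g F = (if F \<in> V then rank F else z)" for F
  have "{F \<in> topspace X. g F \<le> \<alpha>} = U \<alpha> \<union> (topspace X - V)" for \<alpha>
    using z U_subset[of \<alpha>] rank_le_iff by (auto simp: g_def split: if_splits)
  then have "continuous_map X euclidean (\<lambda>F. long_ray_of (g F))"
    using V(1,2) openin_U closedin_U
    by (intro continuous_map_long_ray_of)
      (simp_all only: openin_Un closedin_Un openin_diff closedin_diff openin_topspace closedin_topspace)
  moreover have "\<not> bounded_long_ray ((\<lambda>F. long_ray_of (g F)) ` D)"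
  proof
    assume "bounded_long_ray ((\<lambda>F. long_ray_of (g F)) ` D)"
    then obtain \<alpha> where "\<And>F. F \<in> D \<Longrightarrow> g F < \<alpha>"
      by (fastforce simp: bounded_long_ray_def)
    then have "D \<inter> V \<subseteq> U \<alpha>"
      using \<open>D \<subseteq> Q\<close> rank_le_iff by (fastforce simp: g_def)
    then show False
      using V(3) bounded_in_X_iff by blast
  qed
  moreover have "club_in X (D - V)"
    using D(1) V(1,4) by (simp add: club_in_def closedin_diff)
  ultimately have "\<not> bounded_long_ray ((\<lambda>F. long_ray_of (g F)) ` (D - V))"
    using dir unfolding direction_in_def by (meson Diff_subset)
  \<comment> \<open>Boundedness in the long ray asks for a strict upper bound, so an index above z
    is taken to bound the constant image of \<open>D - V\<close>.\<close>
  moreover obtain \<alpha> where "z < \<alpha>"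
    using countable_bounded_omega1[of "{z}"] by auto
  ultimately show False
    by (auto simp: bounded_long_ray_def g_def)
qed

end

theorem theorem3p1:
  shows "\<exists>Q. Q \<subseteq> topspace beta_omega \<and>
             type_I_space (subtopology beta_omega Q) \<and>
             omega_bounded_space (subtopology beta_omega Q) \<and>
             \<not> (\<exists>D. direction_in (subtopology beta_omega Q) D)"
proof -
  obtain A where "almost_increasing A"
    using exists_almost_increasing by blast
  then interpret almost_increasing A .
  show ?thesis
    using Q_subset type_I_X omega_bounded_X not_direction_in_X by blast
qed

end
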